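(* $k_0(l_1) \le 4+\sqrt{13}$.
   Context: $l_1$ is the Banach space of real sequences $x=(x_n)_{n\ge1}$ with $\|x\|=\sum_n|x_n|<\infty$. For a Banach space $X$, $B_X=\{x\in X:\|x\|\le 1\}$ denotes the (closed) unit ball and $S_X=\{x\in X:\|x\|=1\}$ the unit sphere. A retraction $R:B_X\to S_X$ is a map with $R(x)=x$ for all $x\in S_X$; it is $k$-Lipschitz if $\|R(x)-R(y)\|\le k\|x-y\|$ for all $x,y\in B_X$. For an infinite-dimensional Banach space $X$, $$k_0(X) := \inf\{k>0 : \text{there exists a } k\text{-Lipschitz retraction } R:B_X\to S_X\}.$$ *)

theory Defs
  imports "HOL-Analysis.Analysis"
begin

(* The n-th term of a sequence, n = 1, 2, ..., is stored at index n - 1. *)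
typedef l1 = "{x :: nat \<Rightarrow> real. summable (\<lambda>n. \<bar>x n\<bar>)}"
  morphisms l1_nth Abs_l1
  by (rule exI[of _ "\<lambda>_. 0"]) simp

setup_lifting type_definition_l1

lemma summable_l1_nth: "summable (\<lambda>n. \<bar>l1_nth x n\<bar>)"
  using l1_nth[of x] by simp

lemma l1_eqI: "(\<And>n. l1_nth x n = l1_nth y n) \<Longrightarrow> x = y"
  by (simp add: l1_nth_inject[symmetric] fun_eq_iff)

lemma summable_abs_add:
  fixes x y :: "nat \<Rightarrow> real"
  assumes "summable (\<lambda>n. \<bar>x n\<bar>)" "summable (\<lambda>n. \<bar>y n\<bar>)"
  shows "summable (\<lambda>n. \<bar>x n + y n\<bar>)"
  by (rule summable_comparison_test'[OF summable_add[OF assms], of 0]) simp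

lemma summable_abs_diff:
  fixes x y :: "nat \<Rightarrow> real"
  assumes "summable (\<lambda>n. \<bar>x n\<bar>)" "summable (\<lambda>n. \<bar>y n\<bar>)"
  shows "summable (\<lambda>n. \<bar>x n - y n\<bar>)"
  using summable_abs_add[of x "\<lambda>n. - y n"] assms by simp

instantiation l1 :: real_vector
begin

lift_definition zero_l1 :: l1 is "\<lambda>_. 0" by simp
lift_definition plus_l1 :: "l1 \<Rightarrow> l1 \<Rightarrow> l1" is "\<lambda>x y n. x n + y n"
  by (rule summable_abs_add)
lift_definition minus_l1 :: "l1 \<Rightarrow> l1 \<Rightarrow> l1" is "\<lambda>x y n. x n - y n"
  by (rule summable_abs_diff)
lift_definition uminus_l1 :: "l1 \<Rightarrow> l1" is "\<lambda>x n. - x n" by simp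
lift_definition scaleR_l1 :: "real \<Rightarrow> l1 \<Rightarrow> l1" is "\<lambda>a x n. a * x n"
  by (simp add: abs_mult summable_mult)

instance
  by standard (transfer; simp add: algebra_simps fun_eq_iff)+

end

instantiation l1 :: real_normed_vector
begin

lift_definition norm_l1 :: "l1 \<Rightarrow> real" is "\<lambda>x. \<Sum>n. \<bar>x n\<bar>" .

definition dist_l1 :: "l1 \<Rightarrow> l1 \<Rightarrow> real"
  where "dist_l1 x y = norm (x - y)"

definition sgn_l1 :: "l1 \<Rightarrow> l1"
  where "sgn_l1 x = x /\<^sub>R norm x"

definition uniformity_l1 :: "(l1 \<times> l1) filter"
  where "uniformity_l1 = (INF e\<in>{0<..}. principal {(x, y). dist x y < e})"

definition open_l1 :: "l1 set \<Rightarrow> bool"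
  where "open_l1 S = (\<forall>x\<in>S. \<forall>\<^sub>F (x', y) in uniformity. x' = x \<longrightarrow> y \<in> S)"

instance
proof
  fix x y :: l1 and a :: real
  show "norm x = 0 \<longleftrightarrow> x = 0"
    by transfer (auto simp: suminf_eq_zero_iff fun_eq_iff)
  show "norm (x + y) \<le> norm x + norm y"
  proof transfer
    fix x y :: "nat \<Rightarrow> real"
    assume *: "summable (\<lambda>n. \<bar>x n\<bar>)" "summable (\<lambda>n. \<bar>y n\<bar>)"
    have "(\<Sum>n. \<bar>x n + y n\<bar>) \<le> (\<Sum>n. \<bar>x n\<bar> + \<bar>y n\<bar>)"
      by (intro suminf_le summable_abs_add summable_add * abs_triangle_ineq)
    then show "(\<Sum>n. \<bar>x n + y n\<bar>) \<le> (\<Sum>n. \<bar>x n\<bar>) + (\<Sum>n. \<bar>y n\<bar>)"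
      by (simp add: suminf_add[OF *])
  qed
  show "norm (a *\<^sub>R x) = \<bar>a\<bar> * norm x"
    by transfer (simp add: abs_mult suminf_mult)
qed (rule dist_l1_def sgn_l1_def uniformity_l1_def open_l1_def)+

end

lemma norm_l1_eq: "norm x = (\<Sum>n. \<bar>l1_nth x n\<bar>)"
  by (rule norm_l1.rep_eq)

lemma sum_abs_le_norm_l1: "(\<Sum>i<k. \<bar>l1_nth x i\<bar>) \<le> norm x"
  unfolding norm_l1_eq by (rule sum_le_suminf) (auto simp: summable_l1_nth)

lemma abs_nth_le_norm_l1: "\<bar>l1_nth x i\<bar> \<le> norm x"
proof -
  have "\<bar>l1_nth x i\<bar> \<le> (\<Sum>j<Suc i. \<bar>l1_nth x j\<bar>)"
    by (simp add: sum_nonneg)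
  then show ?thesis
    using sum_abs_le_norm_l1[of x "Suc i"] by linarith
qed

instance l1 :: banach
proof
  fix X :: "nat \<Rightarrow> l1"
  assume X: "Cauchy X"
  have "Cauchy (\<lambda>m. l1_nth (X m) i)" for i
  proof (rule metric_CauchyI)
    fix e :: real
    assume "0 < e"
    then obtain M where M: "\<And>m n. m \<ge> M \<Longrightarrow> n \<ge> M \<Longrightarrow> dist (X m) (X n) < e"
      using metric_CauchyD[OF X] by blast
    have "dist (l1_nth (X m) i) (l1_nth (X n) i) \<le> dist (X m) (X n)" for m n
      using abs_nth_le_norm_l1[of "X m - X n" i]
      by (simp add: dist_norm minus_l1.rep_eq)
    with M show "\<exists>M. \<forall>m\<ge>M. \<forall>n\<ge>M. dist (l1_nth (X m) i) (l1_nth (X n) i) < e"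
      by (meson le_less_trans)
  qed
  then have "\<exists>l. (\<lambda>m. l1_nth (X m) i) \<longlonglongrightarrow> l" for i
    by (simp add: Cauchy_convergent_iff convergent_def)
  then obtain L where L: "\<And>i. (\<lambda>m. l1_nth (X m) i) \<longlonglongrightarrow> L i"
    by metis
  have bound: "\<exists>M. \<forall>n\<ge>M. \<forall>k. (\<Sum>i<k. \<bar>L i - l1_nth (X n) i\<bar>) \<le> e" if "0 < e" for e
  proof -
    obtain M where M: "\<And>m n. m \<ge> M \<Longrightarrow> n \<ge> M \<Longrightarrow> dist (X m) (X n) < e"
      using metric_CauchyD[OF X \<open>0 < e\<close>] by blast
    have "(\<Sum>i<k. \<bar>L i - l1_nth (X n) i\<bar>) \<le> e" if n: "n \<ge> M" for n k
    proof (rule LIMSEQ_le_const2)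
      show "(\<lambda>m. \<Sum>i<k. \<bar>l1_nth (X m) i - l1_nth (X n) i\<bar>)
          \<longlonglongrightarrow> (\<Sum>i<k. \<bar>L i - l1_nth (X n) i\<bar>)"
        by (intro tendsto_intros L)
      have "(\<Sum>i<k. \<bar>l1_nth (X m) i - l1_nth (X n) i\<bar>) \<le> e" if "m \<ge> M" for m
        using sum_abs_le_norm_l1[of "X m - X n" k] M[OF that n]
        by (simp add: dist_norm minus_l1.rep_eq)
      then show "\<exists>N. \<forall>m\<ge>N. (\<Sum>i<k. \<bar>l1_nth (X m) i - l1_nth (X n) i\<bar>) \<le> e"
        by blast
    qed
    then show ?thesis by blast
  qed
  have summ: "summable (\<lambda>i. \<bar>L i - l1_nth (X n) i\<bar>)"
    if "\<forall>k. (\<Sum>i<k. \<bar>L i - l1_nth (X n) i\<bar>) \<le> e" for n e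
    by (rule summableI_nonneg_bounded[of _ e]) (use that in auto)
  obtain n where "\<forall>k. (\<Sum>i<k. \<bar>L i - l1_nth (X n) i\<bar>) \<le> 1"
    using bound[of 1] by auto
  from summable_abs_add[OF summ[OF this] summable_l1_nth[of "X n"]]
  have "summable (\<lambda>i. \<bar>L i\<bar>)" by simp
  then have Y: "l1_nth (Abs_l1 L) = L"
    by (simp add: Abs_l1_inverse)
  have "X \<longlonglongrightarrow> Abs_l1 L"
  proof (rule metric_LIMSEQ_I)
    fix e :: real
    assume "0 < e"
    then obtain M where M: "\<forall>n\<ge>M. \<forall>k. (\<Sum>i<k. \<bar>L i - l1_nth (X n) i\<bar>) \<le> e / 2"
      using bound[of "e / 2"] by auto
    have "dist (X n) (Abs_l1 L) < e" if "n \<ge> M" for n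
    proof -
      have b: "\<forall>k. (\<Sum>i<k. \<bar>L i - l1_nth (X n) i\<bar>) \<le> e / 2"
        using M that by blast
      have "(\<Sum>i. \<bar>L i - l1_nth (X n) i\<bar>) \<le> e / 2"
        by (rule suminf_le_const[OF summ[OF b]]) (use b in blast)
      then have "dist (Abs_l1 L) (X n) \<le> e / 2"
        by (simp add: dist_norm norm_l1_eq minus_l1.rep_eq Y)
      with \<open>0 < e\<close> show ?thesis by (simp add: dist_commute)
    qed
    then show "\<exists>M. \<forall>n\<ge>M. dist (X n) (Abs_l1 L) < e" by blast
  qed
  then show "convergent X" by (rule convergentI)
qed

(* Extended reals make the infimum meaningful for every Banach space: it is
   \<infinity> if no Lipschitz retraction exists (as in finite dimension), whereas
   Inf {} is an unspecified real number. *)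
definition k0 :: "'a::banach itself \<Rightarrow> ereal"
  where "k0 (_ :: 'a itself) =
    Inf (ereal ` {k. k > 0 \<and> (\<exists>R :: 'a \<Rightarrow> 'a.
      retraction (cball 0 1) (sphere 0 1) R \<and> k-lipschitz_on (cball 0 1) R)})"

end

theory Submission
  imports Defs
begin

text \<open>
  It suffices to exhibit one retraction of the ball onto the sphere with Lipschitz constant
  \<open>k = 4 + sqrt 13\<close>. It is built from a deformation that is available on every sphere of \<open>l1\<close>.
  Cut \<open>x\<close> after an initial segment of mass \<open>m\<close>, dividing one coordinate if necessary, keep that
  segment in place and move the rest one index to the right. No cancellation can occur, so the
  norm is unchanged (\<open>norm_slide\<close>). As \<open>m\<close> decreases from the norm of \<open>x\<close> to 0, this moves \<open>x\<close>
  to its right shift, whose first coordinate is 0 and can receive further mass.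

  The retraction uses the radius \<open>r\<close> of \<open>x\<close> as the time of this deformation. For \<open>r \<ge> 3 / k\<close> it
  sends \<open>x\<close> to the slid sequence, with a cut at mass \<open>cutoff r\<close>, divided by \<open>r\<close>. At
  \<open>r = 3 / k\<close> everything has been shifted, and on the smaller ball \<open>x\<close> goes to its shift,
  multiplied by \<open>k / 3\<close>, with the missing mass put into the first coordinate.

  For the Lipschitz estimate, any two points are joined through their common part, the
  coordinatewise median with 0 (\<open>common_part\<close>). The two distances add up exactly, so only pairs
  \<open>x \<preceq> y\<close> remain, where \<open>y\<close> arises from \<open>x\<close> by enlarging coordinates without changing signs.
  If mass \<open>d\<close> is added and the cut moves by \<open>\<Delta>\<close>, then the slid sequences differ by at most
  \<open>d + 2 max (\<bar>\<Delta>\<bar>, \<bar>\<Delta> - d\<bar>)\<close>, the two extremes being that all new mass lies beyond or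
  before the cut (\<open>norm_slide_diff_le\<close>). Including the cost of the factor \<open>1 / r\<close>, the bound \<open>k d\<close>
  requires infinitesimally that \<open>2 - k r / 2 \<le> cutoff' r \<le> k r / 2 - 1\<close>. Such a slope exists
  exactly when \<open>k r \<ge> 3\<close>. Taking the largest slope and \<open>cutoff 1 = 1\<close> gives a quadratic polynomial,
  and its vanishing at \<open>r = 3 / k\<close> is the equation \<open>k\<^sup>2 - 8 k + 3 = 0\<close>, whose larger root is
  \<open>4 + sqrt 13\<close>.
\<close>

section \<open>Norms in the sequence space\<close>

lemma norm_l1_leI:
  assumes "\<And>n. (\<Sum>i<n. \<bar>l1_nth x i\<bar>) \<le> C"
  shows "norm x \<le> C"
  unfolding norm_l1_eq using suminf_le_const[OF summable_l1_nth assms] .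

text \<open>
  This is the form in which additivity of the norm is used throughout: for sequences without
  cancellation in any coordinate.
\<close>

lemma norm_l1_add_if_abs_add:
  assumes "\<And>i. \<bar>l1_nth w i\<bar> = \<bar>l1_nth u i\<bar> + \<bar>l1_nth v i\<bar>"
  shows "norm w = norm u + norm v"
  unfolding norm_l1_eq assms by (rule suminf_add[symmetric]) (rule summable_l1_nth)+

lift_definition prepend :: "real \<Rightarrow> l1 \<Rightarrow> l1"
  is "\<lambda>c x n. case n of 0 \<Rightarrow> c | Suc i \<Rightarrow> x i"
  by (subst summable_Suc_iff[symmetric]) simp

lemma norm_prepend: "norm (prepend c x) = \<bar>c\<bar> + norm x"
proof -
  have "summable (\<lambda>n. \<bar>l1_nth (prepend c x) n\<bar>)"
    by (rule summable_l1_nth)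
  then have "norm (prepend c x)
      = \<bar>l1_nth (prepend c x) 0\<bar> + (\<Sum>n. \<bar>l1_nth (prepend c x) (Suc n)\<bar>)"
    unfolding norm_l1_eq using suminf_split_head by fastforce
  then show ?thesis
    by (simp add: prepend.rep_eq norm_l1_eq)
qed

lemma prepend_diff: "prepend c x - prepend d y = prepend (c - d) (x - y)"
  by transfer (auto simp: fun_eq_iff split: nat.splits)

lemma scaleR_prepend: "a *\<^sub>R prepend c x = prepend (a * c) (a *\<^sub>R x)"
  by transfer (auto simp: fun_eq_iff split: nat.splits)

lemma prepend_add: "prepend c x + prepend d y = prepend (c + d) (x + y)"
  by transfer (auto simp: fun_eq_iff split: nat.splits)

lemma prepend_0_0: "prepend 0 0 = 0"
  by transfer (auto simp: fun_eq_iff split: nat.splits)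

section \<open>Initial segments of prescribed mass\<close>

definition mass :: "l1 \<Rightarrow> nat \<Rightarrow> real"
  where "mass x n = (\<Sum>i<n. \<bar>l1_nth x i\<bar>)"

lemma mass_0 [simp]: "mass x 0 = 0"
  by (simp add: mass_def)

lemma mass_Suc: "mass x (Suc n) = mass x n + \<bar>l1_nth x n\<bar>"
  by (simp add: mass_def)

lemma mass_nonneg: "mass x n \<ge> 0"
  by (simp add: mass_def sum_nonneg)

lemma mass_mono: "i \<le> j \<Longrightarrow> mass x i \<le> mass x j"
  unfolding mass_def by (rule sum_mono2) auto

lemma mass_le_norm: "mass x n \<le> norm x"
  unfolding mass_def by (rule sum_abs_le_norm_l1)

text \<open>
  The absolute values of the initial segment of mass \<open>m\<close> are the increments of the truncated
  partial masses. This covers the coordinates kept in full, the divided one and the removed ones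
  at once, and makes sums over them telescope.
\<close>

definition head_abs :: "real \<Rightarrow> l1 \<Rightarrow> nat \<Rightarrow> real"
  where "head_abs m x n = min (mass x (Suc n)) m - min (mass x n) m"

lemma head_abs_bounds: "0 \<le> head_abs m x n" "head_abs m x n \<le> \<bar>l1_nth x n\<bar>"
  by (auto simp: head_abs_def mass_Suc min_def)

lemma head_abs_mono: "m \<le> m' \<Longrightarrow> head_abs m x n \<le> head_abs m' x n"
  by (auto simp: head_abs_def mass_Suc min_def)

lemma sum_head_abs: "(\<Sum>i<n. head_abs m x i) = min (mass x n) m - min 0 m"
  unfolding head_abs_def by (subst sum_lessThan_telescope) simp

lemma summable_head:
  "summable (\<lambda>n. \<bar>sgn (l1_nth x n) * head_abs m x n\<bar>)"
  by (rule summable_comparison_test'[OF summable_l1_nth[of x], of 0])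
    (auto simp: abs_mult abs_sgn_eq head_abs_bounds)

definition head :: "real \<Rightarrow> l1 \<Rightarrow> l1"
  where "head m x = Abs_l1 (\<lambda>n. sgn (l1_nth x n) * head_abs m x n)"

lemma nth_head: "l1_nth (head m x) n = sgn (l1_nth x n) * head_abs m x n"
  by (simp add: head_def Abs_l1_inverse summable_head)

lemma head_zero: "head 0 x = 0"
  by (rule l1_eqI) (simp add: nth_head head_abs_def zero_l1.rep_eq min_absorb2 mass_nonneg)

lemma head_norm: "head (norm x) x = x"
proof (rule l1_eqI)
  fix n
  have "head_abs (norm x) x n = \<bar>l1_nth x n\<bar>"
    unfolding head_abs_def min_absorb1[OF mass_le_norm] by (simp add: mass_Suc)
  then show "l1_nth (head (norm x) x) n = l1_nth x n"
    by (simp add: nth_head sgn_mult_abs)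
qed

lemma abs_nth_head: "\<bar>l1_nth (head m x) n\<bar> = head_abs m x n"
  using head_abs_bounds[of m x n]
  by (auto simp: nth_head abs_mult abs_sgn_eq)

lemma abs_nth_tail: "\<bar>l1_nth (x - head m x) n\<bar> = \<bar>l1_nth x n\<bar> - head_abs m x n"
proof -
  have "l1_nth (x - head m x) n = sgn (l1_nth x n) * (\<bar>l1_nth x n\<bar> - head_abs m x n)"
    by (simp add: minus_l1.rep_eq nth_head right_diff_distrib sgn_mult_abs)
  then show ?thesis
    using head_abs_bounds[of m x n] by (auto simp: abs_mult abs_sgn_eq)
qed

text \<open>
  For \<open>m \<le> m'\<close> the longer segment dominates the shorter one coordinatewise, so the sum of
  the differences telescopes.
\<close>

lemma norm_head_diff_le: "norm (head m' x - head m x) \<le> \<bar>m' - m\<bar>"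
proof (induction m m' rule: linorder_wlog)
  case (le m m')
  show ?case
  proof (rule norm_l1_leI)
    fix n
    have "\<bar>l1_nth (head m' x - head m x) i\<bar> \<le> head_abs m' x i - head_abs m x i" for i
      using head_abs_mono[OF le, of x i]
      by (auto simp: minus_l1.rep_eq nth_head abs_mult abs_sgn_eq simp flip: right_diff_distrib)
    then have "(\<Sum>i<n. \<bar>l1_nth (head m' x - head m x) i\<bar>)
        \<le> (\<Sum>i<n. head_abs m' x i - head_abs m x i)"
      by (rule sum_mono)
    also have "\<dots> = (min (mass x n) m' - min 0 m') - (min (mass x n) m - min 0 m)"
      by (simp add: sum_subtractf sum_head_abs)
    also have "\<dots> \<le> \<bar>m' - m\<bar>"
      using le mass_nonneg[of x n] by (auto simp: min_def)
    finally show "(\<Sum>i<n. \<bar>l1_nth (head m' x - head m x) i\<bar>) \<le> \<bar>m' - m\<bar>" .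
  qed
next
  case (sym m m')
  then show ?case by (simp add: norm_minus_commute abs_minus_commute)
qed

section \<open>Sliding the tail\<close>

definition slide :: "real \<Rightarrow> l1 \<Rightarrow> l1"
  where "slide m x = head m x + prepend 0 (x - head m x)"

lemma slide_zero: "slide 0 x = prepend 0 x"
  by (simp add: slide_def head_zero)

lemma slide_norm: "slide (norm x) x = x"
  by (simp add: slide_def head_norm prepend_0_0)

text \<open>
  The kept segment and the shifted remainder have disjoint supports: if index \<open>j + 1\<close> carries
  some of the segment, then coordinate \<open>j\<close> was kept in full and has no remainder to shift.
\<close>

lemma norm_slide: "norm (slide m x) = norm x"
proof -
  have "\<bar>l1_nth (slide m x) i\<bar>
      = \<bar>l1_nth (head m x) i\<bar> + \<bar>l1_nth (prepend 0 (x - head m x)) i\<bar>" for i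
  proof (cases i)
    case 0
    then show ?thesis by (simp add: slide_def plus_l1.rep_eq prepend.rep_eq)
  next
    case (Suc j)
    have "l1_nth (head m x) i = 0 \<or> l1_nth (x - head m x) j = 0"
    proof (cases "mass x i \<le> m")
      case True
      then have "\<bar>l1_nth (x - head m x) j\<bar> = 0"
        unfolding abs_nth_tail by (auto simp: Suc head_abs_def mass_Suc)
      then show ?thesis by simp
    next
      case False
      then have "\<bar>l1_nth (head m x) i\<bar> = 0"
        unfolding abs_nth_head by (auto simp: head_abs_def mass_Suc)
      then show ?thesis by simp
    qed
    then show ?thesis
      by (auto simp: slide_def plus_l1.rep_eq prepend.rep_eq Suc)
  qed
  then have "norm (slide m x) = norm (head m x) + norm (x - head m x)"
    by (simp add: norm_l1_add_if_abs_add norm_prepend)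
  also have "\<dots> = norm x"
    by (rule norm_l1_add_if_abs_add[symmetric]) (simp only: abs_nth_head abs_nth_tail)
  finally show ?thesis .
qed

section \<open>Growing a sequence\<close>

text \<open>
  The equation says that each coordinate of \<open>x\<close> lies between 0 and that of \<open>y\<close>. In this form
  it sums up directly to an identity of norms.
\<close>

definition grows_to :: "l1 \<Rightarrow> l1 \<Rightarrow> bool"  (infix "\<preceq>" 50)
  where "x \<preceq> y \<longleftrightarrow> (\<forall>i. \<bar>l1_nth y i\<bar> = \<bar>l1_nth x i\<bar> + \<bar>l1_nth (y - x) i\<bar>)"

lemma norm_grows_to: "x \<preceq> y \<Longrightarrow> norm y = norm x + norm (y - x)"
  by (rule norm_l1_add_if_abs_add) (simp add: grows_to_def)

text \<open>
  Let \<open>p\<close> be the part of the added mass that goes to coordinates wholly before the cut. If the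
  cutoff rises by exactly \<open>p\<close>, then the cut stays at the same place, so the initial segment gains
  this part and the remainder gains the rest of the added mass.
\<close>

lemma head_grows_to:
  assumes "x \<preceq> y"
  obtains p where "0 \<le> p" "p \<le> norm (y - x)"
    "norm (head (m + p) y - head m x) = p"
    "norm ((y - head (m + p) y) - (x - head m x)) = norm (y - x) - p"
proof -
  define d where "d = y - x"
  define D where "D = Abs_l1 (\<lambda>i. if mass x (Suc i) \<le> m then l1_nth d i else 0)"
  have "summable (\<lambda>i. \<bar>if mass x (Suc i) \<le> m then l1_nth d i else 0\<bar>)"
    by (rule summable_comparison_test'[OF summable_l1_nth[of d], of 0]) auto
  then have D: "l1_nth D i = (if mass x (Suc i) \<le> m then l1_nth d i else 0)" for i
    by (simp add: D_def Abs_l1_inverse)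
  have y: "\<bar>l1_nth y i\<bar> = \<bar>l1_nth x i\<bar> + \<bar>l1_nth d i\<bar>" for i
    using assms by (simp add: grows_to_def d_def)
  have mass_y: "mass y n = mass x n + mass d n" for n
    by (simp add: mass_def y sum.distrib)
  define p where "p = norm D"
  have D_le_d: "mass D n \<le> mass d n" for n
    unfolding mass_def by (rule sum_mono) (simp add: D)
  \<comment> \<open>Before the cut, all added mass counts towards \<open>D\<close>. Beyond it, \<open>D\<close> is already exhausted,
    and both truncations have become constant.\<close>
  have cut: "min (mass y n) (m + p) = min (mass x n) m + mass D n" for n
  proof (cases "mass x n \<le> m")
    case True
    then have "l1_nth D i = l1_nth d i" if "i < n" for i
      using mass_mono[of "Suc i" n x] that by (auto simp: D)
    then have "mass D n = mass d n"
      unfolding mass_def by (intro sum.cong) auto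
    with True mass_le_norm[of D n] show ?thesis
      by (simp add: mass_y p_def)
  next
    case False
    then have "l1_nth D i = 0" if "n \<le> i" for i
      using mass_mono[of n "Suc i" x] that by (auto simp: D)
    then have "p = mass D n"
      unfolding p_def mass_def norm_l1_eq by (intro suminf_finite) auto
    with False D_le_d[of n] show ?thesis
      by (simp add: mass_y)
  qed
  have head_abs: "head_abs (m + p) y i = head_abs m x i + \<bar>l1_nth D i\<bar>" for i
    unfolding head_abs_def cut by (simp add: mass_Suc)
  have "l1_nth (head (m + p) y - head m x) i = l1_nth D i" for i
  proof (cases "l1_nth x i = 0")
    case True
    then have "l1_nth y i = l1_nth d i"
      by (simp add: d_def minus_l1.rep_eq)
    moreover have "head_abs m x i = 0"
      using head_abs_bounds[of m x i] True by simp
    ultimately show ?thesis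
      by (simp add: minus_l1.rep_eq nth_head head_abs True D sgn_mult_abs)
  next
    case False
    have dy: "l1_nth d i = l1_nth y i - l1_nth x i"
      by (simp add: d_def minus_l1.rep_eq)
    have "sgn (l1_nth y i) = sgn (l1_nth x i)"
      and "sgn (l1_nth x i) * \<bar>l1_nth d i\<bar> = l1_nth d i"
      using y[of i] False by (auto simp: dy sgn_if abs_if split: if_splits)
    then show ?thesis
      by (simp add: minus_l1.rep_eq nth_head head_abs D algebra_simps)
  qed
  then have hD: "head (m + p) y - head m x = D"
    by (rule l1_eqI)
  have "norm d = norm (d - D) + norm D"
    by (rule norm_l1_add_if_abs_add) (simp add: D minus_l1.rep_eq)
  moreover have "(y - head (m + p) y) - (x - head m x) = d - D"
    by (simp add: d_def hD[symmetric])
  ultimately show thesis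
    using hD norm_ge_zero[of D] norm_ge_zero[of "d - D"]
    by (intro that[of p]) (simp_all add: p_def flip: d_def)
qed

text \<open>
  Raise the cutoff by the \<open>p\<close> of the preceding lemma, at cost \<open>d\<close> (the added mass), then move it
  to its final value; this changes the segment and the remainder by at most \<open>\<bar>m' - m - p\<bar>\<close> each.
  The total is convex in \<open>p \<in> [0, d]\<close>, so the endpoints bound it.
\<close>

lemma norm_slide_diff_le:
  assumes "x \<preceq> y"
  shows "norm (slide m' y - slide m x)
    \<le> norm (y - x) + 2 * max \<bar>m' - m\<bar> \<bar>m' - m - norm (y - x)\<bar>"
proof -
  obtain p where p: "0 \<le> p" "p \<le> norm (y - x)"
    "norm (head (m + p) y - head m x) = p"
    "norm ((y - head (m + p) y) - (x - head m x)) = norm (y - x) - p"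
    using head_grows_to[OF assms] by blast
  define e where "e = head m' y - head (m + p) y"
  have e: "norm e \<le> \<bar>m' - m - p\<bar>"
    using norm_head_diff_le[of m' y "m + p"] by (simp add: e_def algebra_simps)
  have "slide m' y - slide m x
      = (head m' y - head m x) + (prepend 0 (y - head m' y) - prepend 0 (x - head m x))"
    by (simp add: slide_def)
  then have "norm (slide m' y - slide m x)
      \<le> norm (head m' y - head m x) + norm ((y - head m' y) - (x - head m x))"
    using norm_triangle_ineq by (metis prepend_diff norm_prepend abs_zero add_0 diff_zero)
  also have "head m' y - head m x = (head (m + p) y - head m x) + e"
    by (simp add: e_def)
  also have "(y - head m' y) - (x - head m x) = ((y - head (m + p) y) - (x - head m x)) - e"
    by (simp add: e_def)
  also have "norm ((head (m + p) y - head m x) + e)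
        + norm (((y - head (m + p) y) - (x - head m x)) - e)
      \<le> (p + norm e) + ((norm (y - x) - p) + norm e)"
    using norm_triangle_ineq[of "head (m + p) y - head m x" e]
      norm_triangle_ineq4[of "(y - head (m + p) y) - (x - head m x)" e] p by linarith
  also have "\<dots> \<le> norm (y - x) + 2 * max \<bar>m' - m\<bar> \<bar>m' - m - norm (y - x)\<bar>"
    using e p by (auto simp: max_def abs_if split: if_splits)
  finally show ?thesis .
qed

text \<open>
  Along a straight segment mass may shrink in one coordinate while it grows in another. The
  detour through the common part separates the two and is no longer than the segment itself,
  which reduces Lipschitz estimates to pairs related by \<open>\<preceq>\<close>.
\<close>

lemma common_part:
  obtains z where "z \<preceq> x" "z \<preceq> y" "norm (x - y) = norm (x - z) + norm (y - z)"
proof -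
  \<comment> \<open>\<open>f i\<close> is the median of 0 and the two coordinates.\<close>
  define f where "f i = max (min (l1_nth x i) (l1_nth y i))
    (min 0 (max (l1_nth x i) (l1_nth y i)))" for i
  define z where "z = Abs_l1 f"
  have "summable (\<lambda>i. \<bar>f i\<bar>)"
    by (rule summable_comparison_test'[OF summable_l1_nth[of x], of 0])
      (auto simp: f_def max_def min_def abs_if)
  then have z: "l1_nth z = f"
    by (simp add: z_def Abs_l1_inverse)
  show thesis
  proof
    show "z \<preceq> x" "z \<preceq> y"
      unfolding grows_to_def minus_l1.rep_eq z f_def
      by (auto simp: max_def min_def abs_if)
    show "norm (x - y) = norm (x - z) + norm (y - z)"
      by (rule norm_l1_add_if_abs_add) (auto simp: minus_l1.rep_eq z f_def max_def min_def abs_if)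
  qed
qed

lemma grows_to_segment:
  assumes "x \<preceq> y" "0 \<le> s" "s \<le> 1"
  shows "x \<preceq> x + s *\<^sub>R (y - x)" and "x + s *\<^sub>R (y - x) \<preceq> y"
proof -
  have xy: "\<bar>l1_nth y i\<bar> = \<bar>l1_nth x i\<bar> + \<bar>l1_nth y i - l1_nth x i\<bar>" for i
    using assms(1) by (simp add: grows_to_def minus_l1.rep_eq)
  have 1: "\<bar>a + s * (b - a)\<bar> = \<bar>a\<bar> + s * \<bar>b - a\<bar>"
    if "\<bar>b\<bar> = \<bar>a\<bar> + \<bar>b - a\<bar>" for a b :: real
  proof (cases "a = 0")
    case False
    then have "0 \<le> a * (b - a)"
      using that by (auto simp: abs_if zero_le_mult_iff split: if_splits)
    then have "0 \<le> a * (s * (b - a))"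
      using assms(2) by (metis mult.left_commute mult_nonneg_nonneg)
    then have "\<bar>a + s * (b - a)\<bar> = \<bar>a\<bar> + \<bar>s * (b - a)\<bar>"
      using False by (auto simp: zero_le_mult_iff)
    then show ?thesis using assms(2) by (simp add: abs_mult)
  qed (simp add: abs_mult assms)
  have 2: "b - (a + s * (b - a)) = (1 - s) * (b - a)" for a b :: real
    by (simp add: algebra_simps)
  show "x \<preceq> x + s *\<^sub>R (y - x)"
    using 1[OF xy] assms
    by (simp add: grows_to_def minus_l1.rep_eq plus_l1.rep_eq scaleR_l1.rep_eq abs_mult)
  show "x + s *\<^sub>R (y - x) \<preceq> y"
    unfolding grows_to_def minus_l1.rep_eq plus_l1.rep_eq scaleR_l1.rep_eq 2 1[OF xy] abs_mult
  proof
    fix i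
    show "\<bar>l1_nth y i\<bar> = \<bar>l1_nth x i\<bar> + s * \<bar>l1_nth y i - l1_nth x i\<bar>
        + \<bar>1 - s\<bar> * \<bar>l1_nth y i - l1_nth x i\<bar>"
      using xy[of i] assms by (simp add: left_diff_distrib)
  qed
qed

section \<open>The retraction\<close>

definition lip_const :: real where "lip_const = 4 + sqrt 13"

lemma lip_const_quadratic: "lip_const\<^sup>2 = 8 * lip_const - 3"
  by (simp add: lip_const_def power2_eq_square algebra_simps)

lemma lip_const_gt_7: "7 < lip_const"
proof -
  have "3 < sqrt 13" by (rule real_less_rsqrt) simp
  then show ?thesis by (simp add: lip_const_def)
qed

text \<open>
  The solution of \<open>cutoff' r = lip_const * r / 2 - 1\<close> with \<open>cutoff 1 = 1\<close>.
\<close>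

definition cutoff :: "real \<Rightarrow> real"
  where "cutoff r = lip_const * r\<^sup>2 / 4 - r + 2 - lip_const / 4"

text \<open>
  Inside the ball of radius \<open>3 / lip_const\<close> the cut stays at mass 0. Freezing the radius there
  lets a single formula describe the retraction on both regions.
\<close>

definition radius :: "l1 \<Rightarrow> real"
  where "radius x = max (norm x) (3 / lip_const)"

definition sphere_retract :: "l1 \<Rightarrow> l1"
  where "sphere_retract x =
    (1 / radius x) *\<^sub>R slide (cutoff (radius x)) x + prepend (1 - norm x / radius x) 0"

lemma cutoff_one: "cutoff 1 = 1"
  by (simp add: cutoff_def)

lemma cutoff_inner: "cutoff (3 / lip_const) = 0"
  using lip_const_quadratic lip_const_gt_7 by (simp add: cutoff_def field_simps power2_eq_square)

lemma sphere_retract_outer: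
  assumes "3 / lip_const \<le> norm x"
  shows "sphere_retract x = (1 / norm x) *\<^sub>R slide (cutoff (norm x)) x"
proof -
  have "norm x \<noteq> 0"
    using assms lip_const_gt_7 by (smt (verit) divide_pos_pos)
  then show ?thesis
    using assms by (simp add: sphere_retract_def radius_def max_absorb1 prepend_0_0)
qed

lemma sphere_retract_inner:
  assumes "norm x \<le> 3 / lip_const"
  shows "sphere_retract x = prepend (1 - norm x * lip_const / 3) ((lip_const / 3) *\<^sub>R x)"
  using assms
  by (simp add: sphere_retract_def radius_def max_absorb2 cutoff_inner slide_zero scaleR_prepend
      prepend_add)

lemma norm_sphere_retract: "norm (sphere_retract x) = 1"
proof (cases "norm x \<le> 3 / lip_const")
  case True
  then have "norm x * lip_const / 3 \<le> 1"
    using lip_const_gt_7 by (simp add: field_simps)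
  then show ?thesis
    using lip_const_gt_7 by (simp add: sphere_retract_inner[OF True] norm_prepend)
next
  case False
  then have "norm x > 0"
    using lip_const_gt_7 by (smt (verit) divide_pos_pos)
  with False show ?thesis
    by (simp add: sphere_retract_outer norm_slide)
qed

lemma sphere_retract_sphere: "norm x = 1 \<Longrightarrow> sphere_retract x = x"
  using lip_const_gt_7 slide_norm[of x] by (simp add: sphere_retract_outer cutoff_one)

text \<open>
  Both the scaled shift and the first coordinate change by \<open>lip_const / 3\<close> times the added mass,
  so this region needs only two thirds of the constant.
\<close>

lemma sphere_retract_lipschitz_inner:
  assumes "x \<preceq> y" "norm y \<le> 3 / lip_const"
  shows "norm (sphere_retract y - sphere_retract x) \<le> lip_const * norm (y - x)"
proof -
  have y: "norm y = norm x + norm (y - x)"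
    by (rule norm_grows_to[OF assms(1)])
  then have "norm x \<le> 3 / lip_const"
    using assms(2) norm_ge_zero[of "y - x"] by linarith
  then have "sphere_retract y - sphere_retract x
      = prepend ((norm x - norm y) * lip_const / 3) ((lip_const / 3) *\<^sub>R (y - x))"
    using assms(2)
    by (simp add: sphere_retract_inner prepend_diff scaleR_diff_right algebra_simps
        diff_divide_distrib)
  then have "norm (sphere_retract y - sphere_retract x) = (2 / 3) * (lip_const * norm (y - x))"
    using lip_const_gt_7 y by (simp add: norm_prepend abs_mult)
  also have "\<dots> \<le> lip_const * norm (y - x)"
    using lip_const_gt_7 by simp
  finally show ?thesis .
qed

text \<open>
  The outer region is where the constant is exhausted. The new cut is off by \<open>\<Delta> = m' - m\<close>, and
  the bound needs both \<open>\<Delta>\<close> and \<open>d - \<Delta>\<close> to be at most \<open>d (lip_const s / 2 - 1)\<close>. The first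
  holds because the slope of the cutoff increases up to its value at \<open>s\<close>; the second because
  \<open>lip_const * r \<ge> 3\<close>.
\<close>

lemma sphere_retract_lipschitz_outer:
  assumes "x \<preceq> y" "3 / lip_const \<le> norm x"
  shows "norm (sphere_retract y - sphere_retract x) \<le> lip_const * norm (y - x)"
proof -
  define r s d where "r = norm x" and "s = norm y" and "d = norm (y - x)"
  define m m' where "m = cutoff r" and "m' = cutoff s"
  have s: "s = r + d" and d: "0 \<le> d"
    using norm_grows_to[OF assms(1)] by (auto simp: r_def s_def d_def)
  have kr: "3 \<le> lip_const * r"
    using assms(2) lip_const_gt_7 by (simp add: r_def field_simps)
  then have r: "0 < r"
    using lip_const_gt_7 by (smt (verit) mult_nonneg_nonpos)
  have kd: "0 \<le> lip_const * d"
    using d lip_const_gt_7 by simp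
  have "m' - m = d * (lip_const * (r + s) / 4 - 1)"
    by (simp add: m_def m'_def cutoff_def s power2_eq_square algebra_simps add_divide_distrib)
  also have "lip_const * (r + s) / 4 - 1 = lip_const * s / 2 - 1 - lip_const * d / 4"
    by (simp add: s algebra_simps add_divide_distrib)
  finally have dm: "m' - m = d * (lip_const * s / 2 - 1 - lip_const * d / 4)" .
  have ks: "lip_const * s = lip_const * r + lip_const * d"
    by (simp add: s algebra_simps)
  have upper: "m' - m \<le> d * (lip_const * s / 2 - 1)"
    unfolding dm by (intro mult_left_mono d) (use kd in linarith)
  have "d * (2 - lip_const * s / 2) \<le> m' - m"
    unfolding dm by (intro mult_left_mono d) (use kd kr ks in linarith)
  then have lower: "d - (m' - m) \<le> d * (lip_const * s / 2 - 1)"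
    by (simp add: algebra_simps)
  have nonneg: "0 \<le> m' - m"
    unfolding dm by (intro mult_nonneg_nonneg d) (use kd kr ks in linarith)
  have step: "d + 2 * max \<bar>m' - m\<bar> \<bar>m' - m - d\<bar> \<le> d + 2 * (d * (lip_const * s / 2 - 1))"
    using upper lower nonneg d by (auto simp: max_def abs_if)
  \<comment> \<open>First change the radius factor on the fixed sequence \<open>slide m x\<close> of norm \<open>r\<close>, then the
    sequence under the smaller factor.\<close>
  have "sphere_retract y - sphere_retract x
      = (1 / s) *\<^sub>R (slide m' y - slide m x) - (1 / r - 1 / s) *\<^sub>R slide m x"
    using assms(2) d s
    by (simp add: sphere_retract_outer r_def s_def m_def m'_def scaleR_diff_right scaleR_diff_left)
  also have "norm \<dots> \<le> (1 / s) * norm (slide m' y - slide m x) + (1 / r - 1 / s) * r"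
  proof (rule order_trans[OF norm_triangle_ineq4])
    have "1 / s \<le> 1 / r"
      using r s d by (simp add: frac_le)
    then show "norm ((1 / s) *\<^sub>R (slide m' y - slide m x))
          + norm ((1 / r - 1 / s) *\<^sub>R slide m x)
        \<le> (1 / s) * norm (slide m' y - slide m x) + (1 / r - 1 / s) * r"
      using r s d by (simp add: norm_slide r_def[symmetric])
  qed
  also have "\<dots> \<le> (1 / s) * (d + 2 * (d * (lip_const * s / 2 - 1))) + (1 / r - 1 / s) * r"
    using order_trans[OF norm_slide_diff_le[OF assms(1), of m' m, folded d_def] step] r s d
    by (intro add_right_mono mult_left_mono) auto
  also have "(1 / r - 1 / s) * r = d / s"
  proof -
    have "(1 / r - 1 / s) * r = 1 - r / s"
      using r by (simp add: left_diff_distrib)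
    also have "1 - r / s = (s - r) / s"
      using r s d by (subst diff_divide_distrib) simp
    finally show ?thesis
      by (simp add: s)
  qed
  also have "(1 / s) * (d + 2 * (d * (lip_const * s / 2 - 1))) + d / s = lip_const * d"
  proof -
    have "d + 2 * (d * (lip_const * s / 2 - 1)) + d = s * (lip_const * d)"
      by (simp add: algebra_simps)
    moreover have "s \<noteq> 0"
      using r s d by linarith
    ultimately show ?thesis
      by (simp flip: add_divide_distrib)
  qed
  finally show ?thesis by (simp add: d_def)
qed

text \<open>
  When the radius crosses \<open>3 / lip_const\<close>, split at the point of the segment where it does; both
  parts are again ordered, so their lengths add up.
\<close>

lemma sphere_retract_lipschitz_grows_to:
  assumes "x \<preceq> y"
  shows "norm (sphere_retract y - sphere_retract x) \<le> lip_const * norm (y - x)"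
proof -
  have y: "norm y = norm x + norm (y - x)"
    by (rule norm_grows_to[OF assms])
  consider "norm y \<le> 3 / lip_const"
    | "3 / lip_const \<le> norm x"
    | "norm x < 3 / lip_const" "3 / lip_const < norm y"
    by linarith
  then show ?thesis
  proof cases
    case 1
    then show ?thesis by (rule sphere_retract_lipschitz_inner[OF assms])
  next
    case 2
    then show ?thesis by (rule sphere_retract_lipschitz_outer[OF assms])
  next
    case 3
    define s where "s = (3 / lip_const - norm x) / norm (y - x)"
    define z where "z = x + s *\<^sub>R (y - x)"
    have s: "0 \<le> s" "s \<le> 1" "s * norm (y - x) = 3 / lip_const - norm x"
      using 3 y by (auto simp: s_def divide_le_eq_1)
    note xz = grows_to_segment(1)[OF assms s(1,2), folded z_def]
    note zy = grows_to_segment(2)[OF assms s(1,2), folded z_def]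
    have "norm z = 3 / lip_const"
      using norm_grows_to[OF xz] s by (simp add: z_def)
    then have "norm (sphere_retract z - sphere_retract x) \<le> lip_const * norm (z - x)"
      "norm (sphere_retract y - sphere_retract z) \<le> lip_const * norm (y - z)"
      using sphere_retract_lipschitz_inner[OF xz] sphere_retract_lipschitz_outer[OF zy] by auto
    then have "norm (sphere_retract y - sphere_retract x)
        \<le> lip_const * (norm (y - z) + norm (z - x))"
      using norm_triangle_ineq[of "sphere_retract y - sphere_retract z"
          "sphere_retract z - sphere_retract x"] by (simp add: algebra_simps)
    also have "norm (y - z) + norm (z - x) = norm (y - x)"
      using norm_grows_to[OF xz] norm_grows_to[OF zy] y by linarith
    finally show ?thesis .
  qed
qed

lemma sphere_retract_lipschitz:
  "norm (sphere_retract x - sphere_retract y) \<le> lip_const * norm (x - y)"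
proof -
  obtain z where z: "z \<preceq> x" "z \<preceq> y" "norm (x - y) = norm (x - z) + norm (y - z)"
    by (rule common_part)
  have "norm (sphere_retract x - sphere_retract y)
      \<le> norm (sphere_retract x - sphere_retract z) + norm (sphere_retract y - sphere_retract z)"
    using norm_triangle_ineq4[of "sphere_retract x - sphere_retract z"
        "sphere_retract y - sphere_retract z"] by simp
  also have "\<dots> \<le> lip_const * norm (x - z) + lip_const * norm (y - z)"
    using z by (intro add_mono sphere_retract_lipschitz_grows_to)
  finally show ?thesis
    by (simp add: z(3) distrib_left)
qed

theorem theorem3p5:
  shows "k0 TYPE(l1) \<le> ereal (4 + sqrt 13)"
proof -
  have lip: "lip_const-lipschitz_on (cball 0 1) sphere_retract"
    using lip_const_gt_7 sphere_retract_lipschitz by (intro lipschitz_onI) (auto simp: dist_norm)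
  moreover have "retraction (cball 0 1) (sphere 0 1) sphere_retract"
    unfolding retraction_def
    using lipschitz_on_continuous_on[OF lip] norm_sphere_retract sphere_retract_sphere by auto
  ultimately show ?thesis
    unfolding k0_def lip_const_def[symmetric]
    using lip_const_gt_7 by (intro Inf_lower imageI CollectI conjI exI[of _ sphere_retract]) auto
qed

end
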